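(* Let $X$ be a compact metric space, $\mu$ a Borel probability measure on $X$ and $f:X\to X$ a measurable map (not necessarily preserving $\mu$). Then for every $\epsilon>0$, $$\mathscr E_\mu(f)(\epsilon)=\lim_{n\to\infty}\mathcal Q_\epsilon\big((\mathsf e^f_{k})_*\mu\big)_{k\ge n}.$$
   Context: For a compact metric space $Z$, $\mathcal M(Z)$ is the space of Borel probability measures on $Z$ with the Kantorovich–Wasserstein distance $\mathsf d(\nu_1,\nu_2)=\sup_\phi\int_Z\phi\,d(\nu_1-\nu_2)$, the supremum being over $1$-Lipschitz $\phi:Z\to\mathbb R$; it is a compact metric space, so this also defines a distance $\mathsf d$ on $\mathcal M(\mathcal M(X))$ (taking $Z=\mathcal M(X)$). The $n$-th empirical measure is $\mathsf e^f_n(x)=\frac1n\sum_{0\le k<n}\delta_{f^k(x)}\in\mathcal M(X)$; $(\mathsf e^f_k)_*\mu\in\mathcal M(\mathcal M(X))$ is the pushforward of $\mu$ by $x\mapsto\mathsf e^f_k(x)$. The metric emergence $\mathscr E_\mu(f)$ associates to $\epsilon>0$ the minimal number $N$ of probability measures $\mu_1,\dots,\mu_N\in\mathcal M(X)$ such that $\limsup_{n\to\infty}\int\min_{1\le i\le N}\mathsf d(\mathsf e^f_n(x),\mu_i)\,d\mu(x)<\epsilon$. For $n\ge1$, $\mathcal Q_\epsilon((\mathsf e^f_k)_*\mu)_{k\ge n}$ is the minimal number $N$ of measures $\mu_1,\dots,\mu_N\in\mathcal M(X)$ such that, with $H\subset\mathcal M(\mathcal M(X))$ the convex hull of $\{\delta_{\mu_i}:1\le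 i\le N\}$, one has $\sup_{k\ge n}\mathsf d((\mathsf e^f_k)_*\mu,H)<\epsilon$, where $\mathsf d(\cdot,H)$ is the distance to the set $H$. *)

theory Defs
  imports "HOL-Probability.Probability" "HOL-Library.Extended_Nat"
begin

definition metric_borel :: "'a metric \<Rightarrow> 'a measure" where
  "metric_borel Z = sigma (mspace Z) {U. openin (mtopology_of Z) U}"

definition prob_measures :: "'a metric \<Rightarrow> 'a measure set" where
  "prob_measures Z = {\<nu>. sets \<nu> = sets (metric_borel Z) \<and> prob_space \<nu>}"

definition lipschitz1 :: "'a metric \<Rightarrow> ('a \<Rightarrow> real) \<Rightarrow> bool" where
  "lipschitz1 Z \<phi> \<longleftrightarrow> (\<forall>x\<in>mspace Z. \<forall>y\<in>mspace Z. \<bar>\<phi> x - \<phi> y\<bar> \<le> mdist Z x y)"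

definition kantorovich_dist :: "'a metric \<Rightarrow> 'a measure \<Rightarrow> 'a measure \<Rightarrow> real" where
  "kantorovich_dist Z \<nu>1 \<nu>2 =
     (SUP \<phi>\<in>{\<phi>. lipschitz1 Z \<phi>}. (\<integral>x. \<phi> x \<partial>\<nu>1) - (\<integral>x. \<phi> x \<partial>\<nu>2))"

text \<open>
  A value of type \<^typ>\<open>'a metric\<close> carries a distance that is nonnegative and symmetric on the
  whole type, hence the value \<open>0\<close> off the carrier. That this is a genuine metric when \<open>Z\<close> is bounded
  (in particular compact) is shown by \<open>mspace_kantorovich\<close> and \<open>mdist_kantorovich\<close> below; the
  resulting space is bounded again, so the construction can be iterated.
\<close>
definition kantorovich :: "'a metric \<Rightarrow> 'a measure metric" where
  "kantorovich Z = metric (prob_measures Z,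
     \<lambda>\<nu>1 \<nu>2. if \<nu>1 \<in> prob_measures Z \<and> \<nu>2 \<in> prob_measures Z
             then kantorovich_dist Z \<nu>1 \<nu>2 else 0)"

text \<open>The linear combination \<open>\<Sum>i\<in>I. t i \<cdot> \<nu> i\<close> of measures on \<open>M\<close>.\<close>
definition measure_comb ::
    "'a measure \<Rightarrow> 'i set \<Rightarrow> ('i \<Rightarrow> real) \<Rightarrow> ('i \<Rightarrow> 'a measure) \<Rightarrow> 'a measure" where
  "measure_comb M I t \<nu> =
     measure_of (space M) (sets M) (\<lambda>A. \<Sum>i\<in>I. ennreal (t i) * emeasure (\<nu> i) A)"

definition measure_convex_hull :: "'a measure \<Rightarrow> 'a measure set \<Rightarrow> 'a measure set" where
  "measure_convex_hull M S =
     {measure_comb M F t (\<lambda>\<nu>. \<nu>) | F t. finite F \<and> F \<subseteq> S \<and> (\<forall>\<nu>\<in>F. 0 \<le> t \<nu>) \<and> sum t F = 1}"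

text \<open>Meaningful for \<open>n \<ge> 1\<close> only; for \<open>n = 0\<close> it is the zero measure.\<close>
definition empirical :: "'a metric \<Rightarrow> ('a \<Rightarrow> 'a) \<Rightarrow> nat \<Rightarrow> 'a \<Rightarrow> 'a measure" where
  "empirical X f n x =
     measure_comb (metric_borel X) {..<n} (\<lambda>k. 1 / real n)
       (\<lambda>k. return (metric_borel X) ((f ^^ k) x))"

text \<open>
  The minimal numbers below are infima in \<^typ>\<open>enat\<close>, so that they would be \<open>\<infinity>\<close> if there were no
  admissible \<open>N\<close>. As the minimum over, and the distance to, the empty set are \<open>\<infinity>\<close>, \<open>N = 0\<close> is never
  admissible.
\<close>
definition metric_emergence ::
    "'a metric \<Rightarrow> 'a measure \<Rightarrow> ('a \<Rightarrow> 'a) \<Rightarrow> real \<Rightarrow> enat" where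
  "metric_emergence X \<mu> f \<epsilon> = Inf {enat N | N. N \<ge> 1 \<and>
     (\<exists>m. (\<forall>i\<in>{1..N}. m i \<in> prob_measures X) \<and>
        limsup (\<lambda>n. ereal (\<integral>x. Min ((\<lambda>i. mdist (kantorovich X) (empirical X f n x) (m i)) ` {1..N}) \<partial>\<mu>))
          < ereal \<epsilon>)}"

definition mdist_set :: "'a metric \<Rightarrow> 'a \<Rightarrow> 'a set \<Rightarrow> real" where
  "mdist_set Z x S = (INF y\<in>S. mdist Z x y)"

text \<open>
  \<open>quantization_number Z \<epsilon> \<eta> n\<close> is the quantization number at scale \<open>\<epsilon>\<close> of the tail \<open>(\<eta> k)\<close>,
  \<open>k \<ge> n\<close>, of a sequence of probability measures on \<open>Z\<close>.
\<close>
definition quantization_number ::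
    "'a metric \<Rightarrow> real \<Rightarrow> (nat \<Rightarrow> 'a measure) \<Rightarrow> nat \<Rightarrow> enat" where
  "quantization_number Z \<epsilon> \<eta> n = Inf {enat N | N. N \<ge> 1 \<and>
     (\<exists>z. (\<forall>i\<in>{1..N}. z i \<in> mspace Z) \<and>
        (SUP k\<in>{n..}. mdist_set (kantorovich Z) (\<eta> k)
           (measure_convex_hull (metric_borel Z) ((\<lambda>i. return (metric_borel Z) (z i)) ` {1..N}))) < \<epsilon>)}"

definition empirical_law ::
    "'a metric \<Rightarrow> 'a measure \<Rightarrow> ('a \<Rightarrow> 'a) \<Rightarrow> nat \<Rightarrow> 'a measure measure" where
  "empirical_law X \<mu> f k = distr \<mu> (metric_borel (kantorovich X)) (empirical X f k)"


lemma space_metric_borel [simp]: "space (metric_borel Z) = mspace Z"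
  unfolding metric_borel_def using openin_subset[of "mtopology_of Z"]
  by (subst space_measure_of) auto

lemma sets_metric_borel: "sets (metric_borel Z) = sigma_sets (mspace Z) {U. openin (mtopology_of Z) U}"
  unfolding metric_borel_def using openin_subset[of "mtopology_of Z"]
  by (subst sets_measure_of) auto

lemma openin_metric_borel: "openin (mtopology_of Z) U \<Longrightarrow> U \<in> sets (metric_borel Z)"
  by (auto simp: sets_metric_borel)

lemma prob_measuresD:
  assumes "\<nu> \<in> prob_measures Z"
  shows "sets \<nu> = sets (metric_borel Z)" "space \<nu> = mspace Z" "prob_space \<nu>"
  using assms sets_eq_imp_space_eq[of \<nu> "metric_borel Z"] by (auto simp: prob_measures_def)

lemma openin_mtopology_of:
  "openin (mtopology_of Z) U \<longleftrightarrow>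
     U \<subseteq> mspace Z \<and> (\<forall>x\<in>U. \<exists>r>0. \<forall>y\<in>mspace Z. mdist Z x y < r \<longrightarrow> y \<in> U)"
proof -
  interpret Metric_space "mspace Z" "mdist Z" by simp
  show ?thesis
    unfolding mtopology_of_def openin_mtopology by (fastforce simp: subset_iff in_mball)
qed

lemma lipschitz1_measurable:
  assumes "lipschitz1 Z \<phi>"
  shows "\<phi> \<in> borel_measurable (metric_borel Z)"
proof (rule borel_measurableI)
  fix S :: "real set" assume S: "open S"
  have "openin (mtopology_of Z) (\<phi> -` S \<inter> mspace Z)"
    unfolding openin_mtopology_of
  proof safe
    fix x assume x: "x \<in> mspace Z" "\<phi> x \<in> S"
    then obtain r where r: "r > 0" "\<And>t. dist t (\<phi> x) < r \<Longrightarrow> t \<in> S"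
      using S by (auto simp: open_dist)
    show "\<exists>r>0. \<forall>y\<in>mspace Z. mdist Z x y < r \<longrightarrow> y \<in> \<phi> -` S \<inter> mspace Z"
    proof (intro exI[of _ r] conjI ballI impI IntI vimageI2 r)
      fix y assume y: "y \<in> mspace Z" "mdist Z x y < r"
      then show "dist (\<phi> y) (\<phi> x) < r"
        using assms x unfolding lipschitz1_def dist_real_def by (metis abs_minus_commute order_le_less_trans)
    qed auto
  qed
  then show "\<phi> -` S \<inter> space (metric_borel Z) \<in> sets (metric_borel Z)"
    by (simp add: openin_metric_borel)
qed

lemma lipschitz1_integral:
  assumes "lipschitz1 Z \<phi>" "\<nu> \<in> prob_measures Z"
    and B: "\<And>x y. x \<in> mspace Z \<Longrightarrow> y \<in> mspace Z \<Longrightarrow> mdist Z x y \<le> B" and x0: "x0 \<in> mspace Z"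
  shows "integrable \<nu> \<phi>" "\<bar>(\<integral>x. \<phi> x \<partial>\<nu>) - \<phi> x0\<bar> \<le> B"
proof -
  note D = prob_measuresD[OF assms(2)]
  interpret prob_space \<nu> by (rule D)
  have b: "\<bar>\<phi> x - \<phi> x0\<bar> \<le> B" if "x \<in> mspace Z" for x
    using assms(1) B[OF that x0] that x0 unfolding lipschitz1_def by (meson order_trans)
  have m: "\<phi> \<in> borel_measurable \<nu>"
    using lipschitz1_measurable[OF assms(1)] measurable_cong_sets[OF D(1) refl] by blast
  show i: "integrable \<nu> \<phi>"
  proof (rule integrable_const_bound[where B = "\<bar>\<phi> x0\<bar> + B"])
    show "AE x in \<nu>. norm (\<phi> x) \<le> \<bar>\<phi> x0\<bar> + B"
    proof (rule AE_I2)
      fix x assume "x \<in> space \<nu>"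
      then show "norm (\<phi> x) \<le> \<bar>\<phi> x0\<bar> + B" using b[of x] D by simp
    qed
  qed (rule m)
  have "(\<integral>x. \<phi> x \<partial>\<nu>) - \<phi> x0 = (\<integral>x. \<phi> x - \<phi> x0 \<partial>\<nu>)"
    using i by (simp add: prob_space)
  also have "\<bar>\<dots>\<bar> \<le> (\<integral>x. \<bar>\<phi> x - \<phi> x0\<bar> \<partial>\<nu>)"
    by (rule integral_abs_bound)
  also have "\<dots> \<le> (\<integral>x. B \<partial>\<nu>)"
    using i b D by (intro integral_mono) auto
  finally show "\<bar>(\<integral>x. \<phi> x \<partial>\<nu>) - \<phi> x0\<bar> \<le> B" by (simp add: prob_space)
qed

lemma prob_measures_imp_nonempty: "\<nu> \<in> prob_measures Z \<Longrightarrow> \<exists>x. x \<in> mspace Z"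
  using prob_measuresD[of \<nu> Z] prob_space.not_empty[of \<nu>] by auto

lemma lipschitz1_uminus: "lipschitz1 Z \<phi> \<Longrightarrow> lipschitz1 Z (\<lambda>x. - \<phi> x)"
  unfolding lipschitz1_def by (auto simp: abs_minus_commute)

lemma kantorovich_dist_bound:
  assumes B: "\<And>x y. x \<in> mspace Z \<Longrightarrow> y \<in> mspace Z \<Longrightarrow> mdist Z x y \<le> B"
    and "\<nu>1 \<in> prob_measures Z" "\<nu>2 \<in> prob_measures Z" "lipschitz1 Z \<phi>"
  shows "(\<integral>x. \<phi> x \<partial>\<nu>1) - (\<integral>x. \<phi> x \<partial>\<nu>2) \<le> 2 * B"
proof -
  obtain x0 where "x0 \<in> mspace Z" using assms prob_measures_imp_nonempty by blast
  from lipschitz1_integral(2)[OF assms(4,2) B this] lipschitz1_integral(2)[OF assms(4,3) B this]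
  show ?thesis by linarith
qed

lemma kantorovich_dist_upper:
  assumes B: "\<And>x y. x \<in> mspace Z \<Longrightarrow> y \<in> mspace Z \<Longrightarrow> mdist Z x y \<le> B"
    and "\<nu>1 \<in> prob_measures Z" "\<nu>2 \<in> prob_measures Z" "lipschitz1 Z \<phi>"
  shows "(\<integral>x. \<phi> x \<partial>\<nu>1) - (\<integral>x. \<phi> x \<partial>\<nu>2) \<le> kantorovich_dist Z \<nu>1 \<nu>2"
  unfolding kantorovich_dist_def using assms(4) kantorovich_dist_bound[OF B assms(2,3)]
  by (intro cSUP_upper bdd_aboveI2[where M = "2 * B"]) auto

lemma lipschitz1_0: "lipschitz1 Z (\<lambda>x. 0)"
  by (simp add: lipschitz1_def)

lemma kantorovich_dist_least:
  assumes "\<And>\<phi>. lipschitz1 Z \<phi> \<Longrightarrow> (\<integral>x. \<phi> x \<partial>\<nu>1) - (\<integral>x. \<phi> x \<partial>\<nu>2) \<le> c"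
  shows "kantorovich_dist Z \<nu>1 \<nu>2 \<le> c"
  unfolding kantorovich_dist_def using assms lipschitz1_0 by (intro cSUP_least) auto

lemma kantorovich_dist_commute_le:
  assumes B: "\<And>x y. x \<in> mspace Z \<Longrightarrow> y \<in> mspace Z \<Longrightarrow> mdist Z x y \<le> B"
    and "\<nu>1 \<in> prob_measures Z" "\<nu>2 \<in> prob_measures Z"
  shows "kantorovich_dist Z \<nu>1 \<nu>2 \<le> kantorovich_dist Z \<nu>2 \<nu>1"
proof (rule kantorovich_dist_least)
  fix \<phi> assume "lipschitz1 Z \<phi>"
  from kantorovich_dist_upper[OF B assms(3,2) lipschitz1_uminus[OF this]]
  show "(\<integral>x. \<phi> x \<partial>\<nu>1) - (\<integral>x. \<phi> x \<partial>\<nu>2) \<le> kantorovich_dist Z \<nu>2 \<nu>1" by simp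
qed

lemma kantorovich_dist_zero_imp_eq:
  assumes B: "\<And>x y. x \<in> mspace Z \<Longrightarrow> y \<in> mspace Z \<Longrightarrow> mdist Z x y \<le> B"
    and P: "\<nu>1 \<in> prob_measures Z" "\<nu>2 \<in> prob_measures Z" and 0: "kantorovich_dist Z \<nu>1 \<nu>2 = 0"
  shows "\<nu>1 = \<nu>2"
proof -
  note D1 = prob_measuresD[OF P(1)] note D2 = prob_measuresD[OF P(2)]
  interpret p1: prob_space \<nu>1 by (rule D1)
  interpret p2: prob_space \<nu>2 by (rule D2)
  have eqphi: "(\<integral>x. \<phi> x \<partial>\<nu>1) = (\<integral>x. \<phi> x \<partial>\<nu>2)" if "lipschitz1 Z \<phi>" for \<phi>
    using kantorovich_dist_upper[OF B P that] kantorovich_dist_upper[OF B P lipschitz1_uminus[OF that]] 0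
    by simp
  have opens: "measure \<nu>1 U = measure \<nu>2 U" if U: "openin (mtopology_of Z) U" for U
  proof (cases "U = mspace Z")
    case True
    then show ?thesis using p1.prob_space p2.prob_space D1 D2 by simp
  next
    case False
    have sub: "U \<subseteq> mspace Z" using U by (simp add: openin_mtopology_of)
    define C where "C = mspace Z - U"
    have C: "C \<noteq> {}" "C \<subseteq> mspace Z" using False sub by (auto simp: C_def)
    define g where "g x = (INF y\<in>C. mdist Z x y)" for x
    have bdd: "bdd_below ((\<lambda>y. mdist Z x y) ` C)" for x
      by (rule bdd_belowI2[where m = 0]) simp
    have g0: "0 \<le> g x" for x unfolding g_def using C by (intro cINF_greatest) auto
    have gle: "g x \<le> g y + mdist Z x y" if "x \<in> mspace Z" "y \<in> mspace Z" for x y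
    proof -
      have "g x - mdist Z x y \<le> g y"
        unfolding g_def[of y]
      proof (rule cINF_greatest[OF C(1)])
        fix z assume z: "z \<in> C"
        then have "g x \<le> mdist Z x z" unfolding g_def by (intro cINF_lower bdd)
        then show "g x - mdist Z x y \<le> mdist Z y z"
          using mdist_triangle[of x Z y z] that z C by auto
      qed
      then show ?thesis by simp
    qed
    have gC: "g x = 0" if "x \<in> C" for x
    proof -
      have "x \<in> mspace Z" using that C by auto
      moreover have "g x \<le> mdist Z x x" unfolding g_def by (rule cINF_lower[OF bdd that])
      ultimately show ?thesis using g0[of x] mdist_zero[of x Z x] by (metis order_antisym)
    qed
    have gU: "0 < g x" if "x \<in> U" for x
    proof -
      obtain r where r: "r > 0" "\<forall>y\<in>mspace Z. mdist Z x y < r \<longrightarrow> y \<in> U"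
        using U \<open>x \<in> U\<close> unfolding openin_mtopology_of by blast
      have "r \<le> g x" unfolding g_def
      proof (rule cINF_greatest[OF C(1)])
        fix y assume "y \<in> C"
        then show "r \<le> mdist Z x y" using r(2) by (force simp: C_def not_less[symmetric])
      qed
      then show ?thesis using r(1) by simp
    qed
    define h where "h n x = min (1 / real (Suc n)) (g x)" for n x
    have hlip: "lipschitz1 Z (h n)" for n
      unfolding lipschitz1_def
    proof safe
      fix x y assume "x \<in> mspace Z" "y \<in> mspace Z"
      then show "\<bar>h n x - h n y\<bar> \<le> mdist Z x y"
        using gle[of x y] gle[of y x] unfolding h_def mdist_commute[of Z y x] by linarith
    qed
    have lim: "(\<lambda>n. \<integral>x. real (Suc n) * h n x \<partial>\<nu>) \<longlonglongrightarrow> measure \<nu> U" if P: "\<nu> \<in> prob_measures Z" for \<nu>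
    proof -
      note D = prob_measuresD[OF P]
      interpret prob_space \<nu> by (rule D)
      have US: "U \<in> sets \<nu>" using U D openin_metric_borel by auto
      have "(\<lambda>n. \<integral>x. real (Suc n) * h n x \<partial>\<nu>) \<longlonglongrightarrow> (\<integral>x. indicator U x \<partial>\<nu>)"
      proof (rule integral_dominated_convergence[where w = "\<lambda>_. 1"])
        show "indicat_real U \<in> borel_measurable \<nu>" using US by simp
        show "(\<lambda>x. real (Suc n) * h n x) \<in> borel_measurable \<nu>" for n
          using lipschitz1_measurable[OF hlip[of n]] measurable_cong_sets[OF D(1) refl, of borel]
          by (intro borel_measurable_times) auto
        show "AE x in \<nu>. norm (real (Suc n) * h n x) \<le> 1" for n
        proof (rule AE_I2)
          fix x
          have "0 \<le> h n x" "h n x \<le> 1 / real (Suc n)" using g0[of x] by (auto simp: h_def)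
          then show "norm (real (Suc n) * h n x) \<le> 1" by (simp add: field_simps abs_mult)
        qed
        show "AE x in \<nu>. (\<lambda>n. real (Suc n) * h n x) \<longlonglongrightarrow> indicat_real U x"
        proof (rule AE_I2)
          fix x assume x: "x \<in> space \<nu>"
          show "(\<lambda>n. real (Suc n) * h n x) \<longlonglongrightarrow> indicat_real U x"
          proof (cases "x \<in> U")
            case True
            have "\<forall>\<^sub>F n in sequentially. inverse (real (Suc n)) < g x"
              using gU[OF True] LIMSEQ_inverse_real_of_nat order_tendstoD(2) by blast
            then have "\<forall>\<^sub>F n in sequentially. real (Suc n) * h n x = indicat_real U x"
              by eventually_elim (use True in \<open>simp add: h_def min_def inverse_eq_divide del: of_nat_Suc\<close>)
            then show ?thesis by (rule tendsto_eventually)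
          next
            case False
            then have "g x = 0" using gC x D by (auto simp: C_def)
            then show ?thesis using False by (simp add: h_def)
          qed
        qed
      qed auto
      then show ?thesis using US by simp
    qed
    have "(\<lambda>n. \<integral>x. real (Suc n) * h n x \<partial>\<nu>1) = (\<lambda>n. \<integral>x. real (Suc n) * h n x \<partial>\<nu>2)"
      using eqphi[OF hlip] by (simp del: of_nat_Suc)
    then show ?thesis using lim[OF P(1)] lim[OF P(2)] LIMSEQ_unique by simp
  qed
  show ?thesis
  proof (rule measure_eqI_generator_eq[where E = "{U. openin (mtopology_of Z) U}" and \<Omega> = "mspace Z"
        and A = "\<lambda>_. mspace Z"])
    show "Int_stable {U. openin (mtopology_of Z) U}" by (auto simp: Int_stable_def)
    show "{U. openin (mtopology_of Z) U} \<subseteq> Pow (mspace Z)" by (auto simp: openin_mtopology_of)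
    show "sets \<nu>1 = sigma_sets (mspace Z) {U. openin (mtopology_of Z) U}" using D1 sets_metric_borel by metis
    show "sets \<nu>2 = sigma_sets (mspace Z) {U. openin (mtopology_of Z) U}" using D2 sets_metric_borel by metis
    show "range (\<lambda>_::nat. mspace Z) \<subseteq> {U. openin (mtopology_of Z) U}"
      by (auto simp: openin_mtopology_of intro: exI[of _ 1])
  qed (auto simp: p1.emeasure_eq_measure p2.emeasure_eq_measure opens)
qed

lemma Metric_space_kantorovich:
  assumes B: "\<And>x y. x \<in> mspace Z \<Longrightarrow> y \<in> mspace Z \<Longrightarrow> mdist Z x y \<le> B"
  shows "Metric_space (prob_measures Z)
    (\<lambda>\<nu>1 \<nu>2. if \<nu>1 \<in> prob_measures Z \<and> \<nu>2 \<in> prob_measures Z then kantorovich_dist Z \<nu>1 \<nu>2 else 0)"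
proof
  fix x y :: "'a measure"
  show "0 \<le> (if x \<in> prob_measures Z \<and> y \<in> prob_measures Z then kantorovich_dist Z x y else 0)"
    using kantorovich_dist_upper[OF B _ _ lipschitz1_0, of x y] by auto
  show "(if x \<in> prob_measures Z \<and> y \<in> prob_measures Z then kantorovich_dist Z x y else 0) =
        (if y \<in> prob_measures Z \<and> x \<in> prob_measures Z then kantorovich_dist Z y x else 0)"
    using kantorovich_dist_commute_le[OF B, of x y] kantorovich_dist_commute_le[OF B, of y x] by auto
  assume xy: "x \<in> prob_measures Z" "y \<in> prob_measures Z"
  have "kantorovich_dist Z x x = 0"
    unfolding kantorovich_dist_def using lipschitz1_0[of Z]
    by (simp only: diff_self) (rule cSUP_const, auto)
  then show "((if x \<in> prob_measures Z \<and> y \<in> prob_measures Z then kantorovich_dist Z x y else 0) = 0) = (x = y)"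
    using xy kantorovich_dist_zero_imp_eq[OF B xy] by auto
next
  fix x y z assume P: "x \<in> prob_measures Z" "y \<in> prob_measures Z" "z \<in> prob_measures Z"
  have "kantorovich_dist Z x z \<le> kantorovich_dist Z x y + kantorovich_dist Z y z"
  proof (rule kantorovich_dist_least)
    fix \<phi> assume l: "lipschitz1 Z \<phi>"
    show "(\<integral>x. \<phi> x \<partial>x) - (\<integral>x. \<phi> x \<partial>z) \<le> kantorovich_dist Z x y + kantorovich_dist Z y z"
      using kantorovich_dist_upper[OF B P(1,2) l] kantorovich_dist_upper[OF B P(2,3) l] by simp
  qed
  then show "(if x \<in> prob_measures Z \<and> z \<in> prob_measures Z then kantorovich_dist Z x z else 0)
    \<le> (if x \<in> prob_measures Z \<and> y \<in> prob_measures Z then kantorovich_dist Z x y else 0)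
     + (if y \<in> prob_measures Z \<and> z \<in> prob_measures Z then kantorovich_dist Z y z else 0)"
    using P by simp
qed

lemma mspace_kantorovich:
  assumes "\<And>x y. x \<in> mspace Z \<Longrightarrow> y \<in> mspace Z \<Longrightarrow> mdist Z x y \<le> B"
  shows "mspace (kantorovich Z) = prob_measures Z"
  unfolding kantorovich_def by (rule Metric_space.mspace_metric[OF Metric_space_kantorovich[OF assms]])

lemma mdist_kantorovich:
  assumes B: "\<And>x y. x \<in> mspace Z \<Longrightarrow> y \<in> mspace Z \<Longrightarrow> mdist Z x y \<le> B"
    and "\<nu>1 \<in> prob_measures Z" "\<nu>2 \<in> prob_measures Z"
  shows "mdist (kantorovich Z) \<nu>1 \<nu>2 = kantorovich_dist Z \<nu>1 \<nu>2"
  unfolding kantorovich_def using assms(2,3)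
  by (subst Metric_space.mdist_metric[OF Metric_space_kantorovich[OF B]]) auto

lemma mdist_kantorovich_bounded:
  assumes B: "\<And>x y. x \<in> mspace Z \<Longrightarrow> y \<in> mspace Z \<Longrightarrow> mdist Z x y \<le> B"
    and "\<nu>1 \<in> mspace (kantorovich Z)" "\<nu>2 \<in> mspace (kantorovich Z)"
  shows "mdist (kantorovich Z) \<nu>1 \<nu>2 \<le> 2 * B"
  using assms(2,3) kantorovich_dist_bound[OF B]
  by (auto simp: mspace_kantorovich[OF B] mdist_kantorovich[OF B] intro: kantorovich_dist_least)

lemma compact_metric_bounded:
  assumes "compact_space (mtopology_of Z)"
  obtains B where "\<And>x y. x \<in> mspace Z \<Longrightarrow> y \<in> mspace Z \<Longrightarrow> mdist Z x y \<le> B"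
proof -
  interpret Metric_space "mspace Z" "mdist Z" by simp
  have "mbounded (mspace Z)"
    using assms unfolding mtopology_of_def compact_space_def
    by (intro compactin_imp_mbounded) simp
  then show ?thesis using that unfolding mbounded_alt by blast
qed

lemma sets_measure_comb [simp]: "sets (measure_comb M I t \<nu>) = sets M"
  unfolding measure_comb_def using sets.space_closed[of M]
  by (subst sets_measure_of) (auto simp: sets.sigma_sets_eq)

lemma emeasure_measure_comb:
  fixes M :: "'a measure"
  assumes I: "finite I" and s: "\<And>i. i \<in> I \<Longrightarrow> sets (\<nu> i) = sets M" and A: "A \<in> sets M"
  shows "emeasure (measure_comb M I t \<nu>) A = (\<Sum>i\<in>I. ennreal (t i) * emeasure (\<nu> i) A)"
proof (rule emeasure_measure_of[OF measure_comb_def])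
  show "sets M \<subseteq> Pow (space M)" by (rule sets.space_closed)
  show "A \<in> sets (measure_comb M I t \<nu>)" using A by simp
  show "positive (sets (measure_comb M I t \<nu>)) (\<lambda>A. \<Sum>i\<in>I. ennreal (t i) * emeasure (\<nu> i) A)"
    by (simp add: positive_def)
  show "countably_additive (sets (measure_comb M I t \<nu>)) (\<lambda>A. \<Sum>i\<in>I. ennreal (t i) * emeasure (\<nu> i) A)"
    unfolding countably_additive_def
  proof safe
    fix F :: "nat \<Rightarrow> 'a set"
    assume F: "range F \<subseteq> sets (measure_comb M I t \<nu>)" "disjoint_family F"
    have "(\<Sum>n. \<Sum>i\<in>I. ennreal (t i) * emeasure (\<nu> i) (F n)) = (\<Sum>i\<in>I. \<Sum>n. ennreal (t i) * emeasure (\<nu> i) (F n))"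
      by (rule suminf_sum) simp
    also have "\<dots> = (\<Sum>i\<in>I. ennreal (t i) * emeasure (\<nu> i) (\<Union>n. F n))"
    proof (rule sum.cong[OF refl])
      fix i assume "i \<in> I"
      then have "range F \<subseteq> sets (\<nu> i)" using F s by simp
      from suminf_emeasure[OF this F(2)]
      show "(\<Sum>n. ennreal (t i) * emeasure (\<nu> i) (F n)) = ennreal (t i) * emeasure (\<nu> i) (\<Union>n. F n)"
        by (simp add: ennreal_suminf_cmult)
    qed
    finally show "(\<Sum>n. \<Sum>i\<in>I. ennreal (t i) * emeasure (\<nu> i) (F n)) =
        (\<Sum>i\<in>I. ennreal (t i) * emeasure (\<nu> i) (\<Union>n. F n))" .
  qed
qed

end

theory Submission
  imports Defs
begin

text \<open>
  Two facts carry the proof. The first concerns a single probability measure \<open>\<eta>\<close> on a bounded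
  metric space: its distance to the hull of \<open>\<delta>\<close>-masses at \<open>z\<^sub>1, \<dots>, z\<^sub>N\<close> equals
  \<open>\<integral> min\<^sub>i d(y, z\<^sub>i) d\<eta>(y)\<close> (\<open>mdist_set_hull_of_point_masses\<close>). The function \<open>min\<^sub>i d(\<cdot>, z\<^sub>i)\<close> is
  1-Lipschitz and vanishes at every \<open>z\<^sub>i\<close>, so as a test function it shows that no element of the hull
  is closer. Conversely, moving all mass of \<open>\<eta>\<close> to a nearest point \<open>z\<^sub>i\<close> yields an element of the
  hull, and each point \<open>y\<close> travels exactly \<open>min\<^sub>i d(y, z\<^sub>i)\<close>.

  The second is that \<open>x \<mapsto> e\<^sub>k(x)\<close> is measurable for the Borel structure of the Kantorovich metric
  (\<open>measurable_empirical\<close>). Hence the law of \<open>e\<^sub>k\<close> is a probability measure, and changing variables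
  in the first fact gives, for all \<open>k \<ge> 1\<close>,
  \<open>d((e\<^sub>k)\<^sub>*\<mu>, H) = \<integral> min\<^sub>i d(e\<^sub>k(x), \<mu>\<^sub>i) d\<mu>(x)\<close>.

  Both sides of the theorem are thus governed by one bounded sequence \<open>a\<^sub>k\<close> for each choice of
  \<open>\<mu>\<^sub>1, \<dots>, \<mu>\<^sub>N\<close>: emergence asks for \<open>limsup a\<^sub>k < \<epsilon>\<close>, quantization of the tail from \<open>n\<close> on for
  \<open>sup {a\<^sub>k | k \<ge> n} < \<epsilon>\<close>. The limsup is the infimum of the tail suprema, so the first holds iff
  the second holds for some \<open>n\<close> (\<open>limsup_less_iff_SUP_tail_less\<close>). The admissible \<open>N\<close> for emergence
  therefore form the increasing union of those for the tails, and the minimal numbers decrease to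
  that of the union.
\<close>

section \<open>Measures with finitely many atoms\<close>

text \<open>
  Writing a combination of point masses as an image of a weighted counting measure makes the
  integration lemmas for images and for point measures available.
\<close>
lemma measure_comb_return_eq_distr:
  assumes I: "finite I" and p: "\<And>i. i \<in> I \<Longrightarrow> p i \<in> space M"
  shows "measure_comb M I t (\<lambda>i. return M (p i))
    = distr (point_measure I (\<lambda>i. ennreal (t i))) M p"
proof (rule measure_eqI)
  fix A assume "A \<in> sets (measure_comb M I t (\<lambda>i. return M (p i)))"
  then have A: "A \<in> sets M" by simp
  have p': "p \<in> point_measure I (\<lambda>i. ennreal (t i)) \<rightarrow>\<^sub>M M"
    using p by (auto simp: measurable_point_measure_eq1)
  have "emeasure (measure_comb M I t (\<lambda>i. return M (p i))) A
    = (\<Sum>i\<in>I. ennreal (t i) * indicator A (p i))"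
    using I A by (subst emeasure_measure_comb) auto
  also have "\<dots> = (\<Sum>i\<in>{i\<in>I. p i \<in> A}. ennreal (t i))"
    by (subst sum.inter_filter[OF I]) (auto intro!: sum.cong simp: indicator_def)
  also have "\<dots> = emeasure (distr (point_measure I (\<lambda>i. ennreal (t i))) M p) A"
    using I A p' by (subst emeasure_distr)
      (auto simp: emeasure_point_measure_finite space_point_measure intro!: sum.cong)
  finally show "emeasure (measure_comb M I t (\<lambda>i. return M (p i))) A
    = emeasure (distr (point_measure I (\<lambda>i. ennreal (t i))) M p) A" .
qed simp

lemma integral_measure_comb_return:
  fixes \<phi> :: "'a \<Rightarrow> real"
  assumes I: "finite I" and p: "\<And>i. i \<in> I \<Longrightarrow> p i \<in> space M"
    and t: "\<And>i. i \<in> I \<Longrightarrow> 0 \<le> t i" and \<phi>: "\<phi> \<in> borel_measurable M"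
  shows "(\<integral>x. \<phi> x \<partial>measure_comb M I t (\<lambda>i. return M (p i))) = (\<Sum>i\<in>I. t i * \<phi> (p i))"
proof -
  have "p \<in> point_measure I (\<lambda>i. ennreal (t i)) \<rightarrow>\<^sub>M M"
    using p by (auto simp: measurable_point_measure_eq1)
  then show ?thesis
    using I p t \<phi> by (simp add: measure_comb_return_eq_distr integral_distr
        lebesgue_integral_point_measure_finite)
qed

lemma measure_comb_return_in_prob_measures:
  assumes I: "finite I" and p: "\<And>i. i \<in> I \<Longrightarrow> p i \<in> mspace Z"
    and t: "\<And>i. i \<in> I \<Longrightarrow> 0 \<le> t i" "sum t I = 1"
  shows "measure_comb (metric_borel Z) I t (\<lambda>i. return (metric_borel Z) (p i)) \<in> prob_measures Z"
proof -
  let ?h = "measure_comb (metric_borel Z) I t (\<lambda>i. return (metric_borel Z) (p i))"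
  have sp: "space ?h = mspace Z"
    using sets_eq_imp_space_eq[of ?h "metric_borel Z"] by simp
  have top: "mspace Z \<in> sets (metric_borel Z)"
    using sets.top[of "metric_borel Z"] by simp
  have "emeasure ?h (space ?h) = (\<Sum>i\<in>I. ennreal (t i))"
    unfolding sp using I p top by (subst emeasure_measure_comb) (auto intro!: sum.cong)
  also have "\<dots> = 1" using t by (simp add: sum_ennreal)
  finally show ?thesis
    by (auto simp: prob_measures_def intro!: prob_spaceI)
qed

section \<open>Distance to the hull of finitely many point masses\<close>

lemma lipschitz1_mdist:
  assumes "z \<in> mspace Z"
  shows "lipschitz1 Z (\<lambda>y. mdist Z y z)"
  unfolding lipschitz1_def
proof safe
  fix x y assume "x \<in> mspace Z" "y \<in> mspace Z"
  then show "\<bar>mdist Z x z - mdist Z y z\<bar> \<le> mdist Z x y"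
    using mdist_triangle[of x Z y z] mdist_triangle[of y Z x z] assms
    unfolding mdist_commute[of Z y x] by linarith
qed

lemma lipschitz1_Min:
  assumes "finite I" "I \<noteq> {}" "\<And>i. i \<in> I \<Longrightarrow> lipschitz1 Z (g i)"
  shows "lipschitz1 Z (\<lambda>y. Min ((\<lambda>i. g i y) ` I))"
  unfolding lipschitz1_def
proof (intro ballI)
  fix x y assume xy: "x \<in> mspace Z" "y \<in> mspace Z"
  have le: "Min ((\<lambda>i. g i x) ` I) \<le> Min ((\<lambda>i. g i y) ` I) + mdist Z x y"
    if xy: "x \<in> mspace Z" "y \<in> mspace Z" for x y
  proof -
    have "Min ((\<lambda>i. g i y) ` I) \<in> (\<lambda>i. g i y) ` I"
      using assms by (intro Min_in) auto
    then obtain i where i: "i \<in> I" "Min ((\<lambda>i. g i y) ` I) = g i y" by auto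
    have "Min ((\<lambda>i. g i x) ` I) \<le> g i x" using assms i by (intro Min_le) auto
    moreover have "\<bar>g i x - g i y\<bar> \<le> mdist Z x y"
      using assms(3)[OF i(1)] xy by (auto simp: lipschitz1_def)
    ultimately show ?thesis using i by linarith
  qed
  show "\<bar>Min ((\<lambda>i. g i x) ` I) - Min ((\<lambda>i. g i y) ` I)\<bar> \<le> mdist Z x y"
    using le[OF xy] le[OF xy(2,1)] unfolding mdist_commute[of Z y x] by linarith
qed

lemma singleton_in_sets_metric_borel:
  assumes "z \<in> mspace Z"
  shows "{z} \<in> sets (metric_borel Z)"
proof -
  have "(\<lambda>y. mdist Z y z) -` {0} \<inter> space (metric_borel Z) \<in> sets (metric_borel Z)"
    by (rule measurable_sets[OF lipschitz1_measurable[OF lipschitz1_mdist[OF assms]]]) simp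
  also have "(\<lambda>y. mdist Z y z) -` {0} \<inter> space (metric_borel Z) = {z}"
    using assms by auto
  finally show ?thesis .
qed

text \<open>
  Needed because the convex hull is indexed by the point masses themselves: weights on them can be
  transported to weights on the points.
\<close>
lemma inj_on_return: "inj_on (return (metric_borel Z)) (mspace Z)"
proof (rule inj_onI)
  fix x y assume xy: "x \<in> mspace Z" "y \<in> mspace Z"
    and eq: "return (metric_borel Z) x = return (metric_borel Z) y"
  have "indicator {x} y = (1::ennreal)"
    using arg_cong[OF eq, of "\<lambda>\<nu>. emeasure \<nu> {x}"] singleton_in_sets_metric_borel[OF xy(1)] by simp
  then show "x = y" by (simp add: indicator_def split: if_splits)
qed

text \<open>
  A convex combination of some of the point masses is one of all of them, with weight \<open>0\<close> at the
  points that do not occur. This replaces the varying finite set in the definition of the hull by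
  the fixed set \<open>P\<close>.
\<close>
lemma hull_of_point_masses_eq:
  assumes P: "finite P" "P \<subseteq> mspace Z"
  shows "measure_convex_hull (metric_borel Z) (return (metric_borel Z) ` P) =
    {measure_comb (metric_borel Z) P t (return (metric_borel Z)) | t.
       (\<forall>z\<in>P. 0 \<le> t z) \<and> sum t P = 1}" (is "?L = ?R")
proof
  let ?r = "return (metric_borel Z)"
  have inj: "inj_on ?r Q" if "Q \<subseteq> P" for Q
    using inj_on_subset[OF inj_on_return, of Q] that P by auto
  have reindex: "measure_comb (metric_borel Z) (?r ` Q) t (\<lambda>\<nu>. \<nu>)
      = measure_comb (metric_borel Z) Q (t \<circ> ?r) ?r" if "Q \<subseteq> P" for Q t
    unfolding measure_comb_def using inj[OF that] by (simp add: sum.reindex)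
  show "?L \<subseteq> ?R"
  proof
    fix h assume "h \<in> ?L"
    then obtain F t where F: "h = measure_comb (metric_borel Z) F t (\<lambda>\<nu>. \<nu>)" "F \<subseteq> ?r ` P"
      "\<forall>\<nu>\<in>F. 0 \<le> t \<nu>" "sum t F = 1"
      unfolding measure_convex_hull_def by auto
    obtain Q where Q: "Q \<subseteq> P" "F = ?r ` Q" using F(2) by (meson subset_imageE)
    define s where "s z = (if z \<in> Q then t (?r z) else 0)" for z
    have "sum s P = sum t F"
      unfolding Q(2) sum.reindex[OF inj[OF Q(1)]] s_def
      using Q P by (intro sum.mono_neutral_cong_right) auto
    moreover have "(\<Sum>z\<in>Q. ennreal (t (?r z)) * emeasure (?r z) A)
        = (\<Sum>z\<in>P. ennreal (s z) * emeasure (?r z) A)" for A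
      using Q P by (intro sum.mono_neutral_cong_left) (auto simp: s_def)
    then have "h = measure_comb (metric_borel Z) P s ?r"
      unfolding F(1) Q(2) reindex[OF Q(1)] by (simp add: measure_comb_def)
    moreover have "\<forall>z\<in>P. 0 \<le> s z" using F(3) Q(2) by (auto simp: s_def)
    ultimately show "h \<in> ?R" using F(4) by auto
  qed
  show "?R \<subseteq> ?L"
  proof
    fix h assume "h \<in> ?R"
    then obtain t where t: "h = measure_comb (metric_borel Z) P t ?r" "\<forall>z\<in>P. 0 \<le> t z" "sum t P = 1"
      by auto
    define s where "s = t \<circ> inv_into P ?r"
    have s: "s (?r z) = t z" if "z \<in> P" for z
      using that inj[OF subset_refl] by (simp add: s_def)
    have "h = measure_comb (metric_borel Z) (?r ` P) s (\<lambda>\<nu>. \<nu>)"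
      unfolding t(1) reindex[OF subset_refl] by (simp add: measure_comb_def s cong: sum.cong)
    moreover have "sum s (?r ` P) = 1"
      using t(3) inj[OF subset_refl] by (simp add: sum.reindex s cong: sum.cong)
    ultimately show "h \<in> ?L"
      unfolding measure_convex_hull_def using P t(2) s
      by (intro CollectI exI[of _ "?r ` P"] exI[of _ s] conjI) auto
  qed
qed

text \<open>
  A minimizing index can be selected measurably: a new index is taken where it does at least as
  well as the index selected so far.
\<close>
lemma measurable_argmin:
  fixes g :: "'i \<Rightarrow> 'a \<Rightarrow> real"
  assumes "finite I" "I \<noteq> {}" and "\<And>i. i \<in> I \<Longrightarrow> g i \<in> borel_measurable M"
  shows "\<exists>s. s \<in> M \<rightarrow>\<^sub>M count_space I \<and> (\<forall>y\<in>space M. g (s y) y = Min ((\<lambda>i. g i y) ` I))"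
  using assms
proof (induction I rule: finite_ne_induct)
  case (singleton i)
  show ?case by (intro exI[of _ "\<lambda>_. i"]) auto
next
  case (insert i I)
  have "\<exists>s. s \<in> M \<rightarrow>\<^sub>M count_space I \<and> (\<forall>y\<in>space M. g (s y) y = Min ((\<lambda>i. g i y) ` I))"
    by (rule insert.IH) (simp add: insert.prems)
  then obtain s where s: "s \<in> M \<rightarrow>\<^sub>M count_space I"
    and sg: "\<And>y. y \<in> space M \<Longrightarrow> g (s y) y = Min ((\<lambda>i. g i y) ` I)"
    by blast
  have [measurable]: "g j \<in> borel_measurable M" if "j \<in> insert i I" for j
    using insert.prems that by blast
  have "(\<lambda>y. Min ((\<lambda>i. g i y) ` I)) \<in> borel_measurable M"
    using insert by (intro borel_measurable_Min) auto
  then have "{y \<in> space M. g i y \<le> Min ((\<lambda>i. g i y) ` I)} \<in> sets M"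
    using insert.prems by (intro borel_measurable_le) auto
  moreover have "s \<in> M \<rightarrow>\<^sub>M count_space (insert i I)"
    by (rule measurable_compose[OF s, of "\<lambda>x. x"]) auto
  ultimately have "(\<lambda>y. if g i y \<le> Min ((\<lambda>i. g i y) ` I) then i else s y) \<in> M \<rightarrow>\<^sub>M count_space (insert i I)"
    by (intro measurable_If) auto
  moreover have "g (if g i y \<le> Min ((\<lambda>i. g i y) ` I) then i else s y) y = Min ((\<lambda>i. g i y) ` insert i I)"
    if "y \<in> space M" for y
    using insert.hyps sg[OF that] by (auto simp: min_def)
  ultimately show ?case by blast
qed

text \<open>
  The best approximation of \<open>\<eta>\<close> from the hull is its image under a nearest-point selection \<open>p\<close>.
  Optimality is witnessed by the distance function \<open>min\<^sub>i d(\<cdot>, z\<^sub>i)\<close>: it is a legitimate test function,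
  and its integral against anything in the hull is \<open>0\<close>.
\<close>
lemma mdist_set_hull_of_point_masses:
  assumes B: "\<And>x y. x \<in> mspace Z \<Longrightarrow> y \<in> mspace Z \<Longrightarrow> mdist Z x y \<le> B"
    and \<eta>: "\<eta> \<in> prob_measures Z"
    and I: "finite I" "I \<noteq> {}" "\<And>i. i \<in> I \<Longrightarrow> z i \<in> mspace Z"
  shows "mdist_set (kantorovich Z) \<eta>
      (measure_convex_hull (metric_borel Z) ((\<lambda>i. return (metric_borel Z) (z i)) ` I))
    = (\<integral>y. Min ((\<lambda>i. mdist Z y (z i)) ` I) \<partial>\<eta>)"
proof -
  let ?M = "metric_borel Z"
  let ?g = "\<lambda>y. Min ((\<lambda>i. mdist Z y (z i)) ` I)"
  define P where "P = z ` I"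
  have P: "finite P" "P \<subseteq> mspace Z" "P \<noteq> {}" using I by (auto simp: P_def)
  define H where "H = measure_convex_hull ?M (return ?M ` P)"
  have H_eq: "measure_convex_hull ?M ((\<lambda>i. return ?M (z i)) ` I) = H"
    by (simp add: H_def P_def image_image)
  note D = prob_measuresD[OF \<eta>]
  interpret prob_space \<eta> by (rule D)
  have meas_\<eta>: "\<psi> \<in> borel_measurable \<eta> \<longleftrightarrow> \<psi> \<in> borel_measurable ?M" for \<psi> :: "'a \<Rightarrow> real"
    using measurable_cong_sets[OF D(1) refl, of "borel :: real measure"] by auto
  have glip: "lipschitz1 Z ?g"
    using I by (intro lipschitz1_Min lipschitz1_mdist) auto
  obtain x0 where x0: "x0 \<in> mspace Z" using prob_measures_imp_nonempty[OF \<eta>] by blast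
  have Hprob: "h \<in> prob_measures Z" if "h \<in> H" for h
    using that P unfolding H_def hull_of_point_masses_eq[OF P(1,2)]
    by (auto intro: measure_comb_return_in_prob_measures[where p = "\<lambda>z. z"])
  have lower: "(\<integral>y. ?g y \<partial>\<eta>) \<le> mdist (kantorovich Z) \<eta> h" if h: "h \<in> H" for h
  proof -
    obtain t where t: "h = measure_comb ?M P t (return ?M)" "\<forall>z\<in>P. 0 \<le> t z"
      using h unfolding H_def hull_of_point_masses_eq[OF P(1,2)] by auto
    have g0: "?g y = 0" if y: "y \<in> P" for y
    proof -
      obtain i where i: "i \<in> I" "y = z i" using y by (auto simp: P_def)
      have "0 \<in> (\<lambda>i. mdist Z y (z i)) ` I" using i I(3)[OF i(1)] by force
      then show ?thesis using I by (intro Min_eqI) auto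
    qed
    have "(\<integral>y. ?g y \<partial>h) = (\<Sum>y\<in>P. t y * ?g y)"
      unfolding t(1) using P t(2) lipschitz1_measurable[OF glip]
      by (intro integral_measure_comb_return) auto
    also have "\<dots> = 0" using g0 by simp
    finally show ?thesis
      using kantorovich_dist_upper[OF B \<eta> Hprob[OF h] glip] mdist_kantorovich[OF B \<eta> Hprob[OF h]]
      by simp
  qed
  have "(\<lambda>y. mdist Z y (z i)) \<in> borel_measurable \<eta>" if "i \<in> I" for i
    using lipschitz1_measurable[OF lipschitz1_mdist[OF I(3)[OF that]]] meas_\<eta> by simp
  from measurable_argmin[where g = "\<lambda>i y. mdist Z y (z i)", OF I(1,2) this] obtain s where s: "s \<in> \<eta> \<rightarrow>\<^sub>M count_space I"
    and sg: "\<And>y. y \<in> space \<eta> \<Longrightarrow> mdist Z y (z (s y)) = ?g y" by blast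
  define p where "p = (\<lambda>y. z (s y))"
  have p: "p \<in> \<eta> \<rightarrow>\<^sub>M count_space P"
    unfolding p_def by (rule measurable_compose[OF s]) (auto simp: P_def)
  have pg: "mdist Z y (p y) = ?g y" if "y \<in> mspace Z" for y
    using sg[of y] that D by (simp add: p_def)
  have pP: "p y \<in> P" if "y \<in> mspace Z" for y
    using measurable_space[OF p] that D by simp
  have pM: "p \<in> \<eta> \<rightarrow>\<^sub>M ?M"
    using P(2) by (intro measurable_compose[OF p, of "\<lambda>x. x", simplified]) auto
  \<comment> \<open>\<open>h\<close> is the image of \<open>\<eta>\<close> under \<open>p\<close>, written out so that it is visibly a convex combination.\<close>
  define h where "h = measure_comb ?M P (\<lambda>z. prob (p -` {z} \<inter> space \<eta>)) (return ?M)"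
  have fib: "p -` {z} \<inter> space \<eta> \<in> events" if "z \<in> P" for z
    using measurable_sets[OF p, of "{z}"] that by simp
  have total: "(\<Sum>z\<in>P. prob (p -` {z} \<inter> space \<eta>)) = 1"
  proof -
    have "(\<Sum>z\<in>P. prob (p -` {z} \<inter> space \<eta>)) = prob (\<Union>z\<in>P. p -` {z} \<inter> space \<eta>)"
      using fib P by (intro finite_measure_finite_Union[symmetric]) (auto simp: disjoint_family_on_def)
    also have "(\<Union>z\<in>P. p -` {z} \<inter> space \<eta>) = space \<eta>"
      using pP D by auto
    finally show ?thesis by (simp add: prob_space)
  qed
  have hH: "h \<in> H"
    unfolding H_def hull_of_point_masses_eq[OF P(1,2)] h_def using total
    by (intro CollectI exI[of _ "\<lambda>z. prob (p -` {z} \<inter> space \<eta>)"]) auto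
  have h_distr: "integral\<^sup>L h \<phi> = (\<integral>y. \<phi> (p y) \<partial>\<eta>)" if \<phi>: "lipschitz1 Z \<phi>" for \<phi>
  proof -
    have "integral\<^sup>L h \<phi> = (\<Sum>z\<in>P. prob (p -` {z} \<inter> space \<eta>) * \<phi> z)"
      unfolding h_def using P lipschitz1_measurable[OF \<phi>]
      by (intro integral_measure_comb_return) auto
    also have "\<dots> = (\<integral>y. (\<Sum>z\<in>P. indicator (p -` {z} \<inter> space \<eta>) y * \<phi> z) \<partial>\<eta>)"
      using fib by (subst Bochner_Integration.integral_sum) (auto simp: emeasure_eq_measure)
    also have "\<dots> = (\<integral>y. \<phi> (p y) \<partial>\<eta>)"
    proof (rule Bochner_Integration.integral_cong[OF refl])
      fix y assume y: "y \<in> space \<eta>"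
      have "(\<Sum>z\<in>P. indicator (p -` {z} \<inter> space \<eta>) y * \<phi> z) = (\<Sum>z\<in>P. if z = p y then \<phi> z else 0)"
        using y by (intro sum.cong) (auto simp: indicator_def)
      then show "(\<Sum>z\<in>P. indicator (p -` {z} \<inter> space \<eta>) y * \<phi> z) = \<phi> (p y)"
        using P pP y D by simp
    qed
    finally show ?thesis .
  qed
  have "kantorovich_dist Z \<eta> h \<le> (\<integral>y. ?g y \<partial>\<eta>)"
  proof (rule kantorovich_dist_least)
    fix \<phi> assume \<phi>: "lipschitz1 Z \<phi>"
    note i1 = lipschitz1_integral(1)[OF \<phi> \<eta> B x0]
    have "integrable \<eta> (\<lambda>y. \<phi> (p y))"
    proof (rule integrable_const_bound[where B = "Max ((\<lambda>z. \<bar>\<phi> z\<bar>) ` P)"])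
      show "(\<lambda>y. \<phi> (p y)) \<in> borel_measurable \<eta>"
        using measurable_compose[OF pM lipschitz1_measurable[OF \<phi>]] .
      show "AE y in \<eta>. norm (\<phi> (p y)) \<le> Max ((\<lambda>z. \<bar>\<phi> z\<bar>) ` P)"
        using P pP D by (intro AE_I2) (auto intro!: Max_ge)
    qed
    note i2 = this
    have "(\<integral>y. \<phi> y \<partial>\<eta>) - (\<integral>y. \<phi> y \<partial>h) = (\<integral>y. \<phi> y - \<phi> (p y) \<partial>\<eta>)"
      using i1 i2 h_distr[OF \<phi>] by simp
    also have "\<dots> \<le> (\<integral>y. ?g y \<partial>\<eta>)"
    proof (rule integral_mono)
      show "integrable \<eta> ?g" by (rule lipschitz1_integral(1)[OF glip \<eta> B x0])
      show "integrable \<eta> (\<lambda>y. \<phi> y - \<phi> (p y))" using i1 i2 by simp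
      fix y assume "y \<in> space \<eta>"
      then have y: "y \<in> mspace Z" using D by simp
      then have "\<bar>\<phi> y - \<phi> (p y)\<bar> \<le> mdist Z y (p y)"
        using \<phi> pP[OF y] P by (auto simp: lipschitz1_def)
      then show "\<phi> y - \<phi> (p y) \<le> ?g y" unfolding pg[OF y] by linarith
    qed
    finally show "(\<integral>y. \<phi> y \<partial>\<eta>) - (\<integral>y. \<phi> y \<partial>h) \<le> (\<integral>y. ?g y \<partial>\<eta>)" .
  qed
  then have upper: "mdist (kantorovich Z) \<eta> h \<le> (\<integral>y. ?g y \<partial>\<eta>)"
    using mdist_kantorovich[OF B \<eta> Hprob[OF hH]] by simp
  show ?thesis
    unfolding H_eq mdist_set_def
  proof (rule cInf_eq_minimum)
    show "(\<integral>y. ?g y \<partial>\<eta>) \<in> mdist (kantorovich Z) \<eta> ` H"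
      using lower[OF hH] upper hH by (intro image_eqI[of _ _ h]) auto
  qed (use lower in auto)
qed

section \<open>The empirical measure depends measurably on the point\<close>

text \<open>
  Total boundedness gives finite \<open>1 / (n + 1)\<close>-nets; their union over all \<open>n\<close> is the countable
  dense set.
\<close>
lemma separable_if_compact_metric:
  assumes "compact_space (mtopology_of Z)"
  obtains C where "countable C" "C \<subseteq> mspace Z"
    "\<And>x r. x \<in> mspace Z \<Longrightarrow> 0 < r \<Longrightarrow> \<exists>c\<in>C. mdist Z c x < r"
proof -
  interpret Metric_space "mspace Z" "mdist Z" by simp
  have "mtotally_bounded (mspace Z)"
    using assms unfolding mtopology_of_def compact_space_def
    by (intro compactin_imp_mtotally_bounded) simp
  then have "\<forall>n. \<exists>K. finite K \<and> K \<subseteq> mspace Z \<and> mspace Z \<subseteq> (\<Union>x\<in>K. mball x (1 / real (Suc n)))"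
    unfolding mtotally_bounded_def by (simp del: of_nat_Suc)
  then obtain K where K: "\<And>n. finite (K n)" "\<And>n. K n \<subseteq> mspace Z"
    "\<And>n. mspace Z \<subseteq> (\<Union>x\<in>K n. mball x (1 / real (Suc n)))"
    by metis
  show ?thesis
  proof (rule that[of "\<Union>n. K n"])
    show "countable (\<Union>n. K n)" using K(1) by (auto intro: countable_finite)
    show "(\<Union>n. K n) \<subseteq> mspace Z" using K(2) by auto
    fix x and r :: real assume xr: "x \<in> mspace Z" "0 < r"
    obtain n where n: "1 / real (Suc n) < r" using nat_approx_posE[OF xr(2)] by metis
    obtain c where "c \<in> K n" "mdist Z c x < 1 / real (Suc n)" using K(3)[of n] xr by (auto simp: in_mball)
    then show "\<exists>c\<in>\<Union>n. K n. mdist Z c x < r" using n by (intro bexI[of _ c]) auto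
  qed
qed

text \<open>
  The empirical measure as a function of a finite sequence of points that need not be an orbit. Moving
  each point by at most \<open>r\<close> moves the average by at most \<open>r\<close>, so averages of points from a dense set
  approximate those of all points.
\<close>
definition average_of_points :: "'a metric \<Rightarrow> nat \<Rightarrow> (nat \<Rightarrow> 'a) \<Rightarrow> 'a measure" where
  "average_of_points Z n p =
     measure_comb (metric_borel Z) {..<n} (\<lambda>k. 1 / real n) (\<lambda>k. return (metric_borel Z) (p k))"

lemma average_of_points_in_prob_measures:
  assumes "0 < n" "\<And>k. k < n \<Longrightarrow> p k \<in> mspace Z"
  shows "average_of_points Z n p \<in> prob_measures Z"
  unfolding average_of_points_def using assms
  by (intro measure_comb_return_in_prob_measures) auto

text \<open>
  Matching the \<open>k\<close>-th points with each other transports one average to the other at cost at most \<open>r\<close>.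
\<close>
lemma kantorovich_dist_average_of_points_le:
  assumes n: "0 < n" and p: "\<And>k. k < n \<Longrightarrow> p k \<in> mspace Z" "\<And>k. k < n \<Longrightarrow> q k \<in> mspace Z"
    and r: "\<And>k. k < n \<Longrightarrow> mdist Z (p k) (q k) \<le> r"
  shows "kantorovich_dist Z (average_of_points Z n p) (average_of_points Z n q) \<le> r"
proof (rule kantorovich_dist_least)
  fix \<phi> assume \<phi>: "lipschitz1 Z \<phi>"
  have int: "integral\<^sup>L (average_of_points Z n p) \<phi> = (\<Sum>k<n. 1 / real n * \<phi> (p k))"
    if "\<And>k. k < n \<Longrightarrow> p k \<in> mspace Z" for p
    unfolding average_of_points_def using that lipschitz1_measurable[OF \<phi>]
    by (intro integral_measure_comb_return) auto
  have "integral\<^sup>L (average_of_points Z n p) \<phi> - integral\<^sup>L (average_of_points Z n q) \<phi>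
    = (\<Sum>k<n. 1 / real n * (\<phi> (p k) - \<phi> (q k)))"
    using p by (simp add: int sum_subtractf diff_divide_distrib)
  also have "\<dots> \<le> (\<Sum>k<n. 1 / real n * r)"
  proof (rule sum_mono)
    fix k assume "k \<in> {..<n}"
    then have "\<bar>\<phi> (p k) - \<phi> (q k)\<bar> \<le> mdist Z (p k) (q k)" "mdist Z (p k) (q k) \<le> r"
      using \<phi> p r by (auto simp: lipschitz1_def)
    then show "1 / real n * (\<phi> (p k) - \<phi> (q k)) \<le> 1 / real n * r"
      by (intro mult_left_mono) auto
  qed
  also have "\<dots> = r" using n by simp
  finally show "integral\<^sup>L (average_of_points Z n p) \<phi> - integral\<^sup>L (average_of_points Z n q) \<phi> \<le> r" .
qed

text \<open>
  The preimage of an open set \<open>U\<close> is a countable union of measurable sets. Take a countable dense set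
  \<open>C\<close> of points, and consider the pairs of a list \<open>cs\<close> in \<open>C\<close> and a rational radius \<open>r\<close> for which the
  closed ball of radius \<open>r\<close> around the average of \<open>cs\<close> lies in \<open>U\<close>. The average at \<open>x\<close> is in \<open>U\<close>
  iff, for one of these pairs, every \<open>p k x\<close> is within \<open>r\<close> of \<open>cs ! k\<close>.
\<close>
lemma measurable_average_of_points:
  assumes Z: "compact_space (mtopology_of Z)" and n: "0 < n"
    and p: "\<And>k. k < n \<Longrightarrow> p k \<in> M \<rightarrow>\<^sub>M metric_borel Z"
  shows "(\<lambda>x. average_of_points Z n (\<lambda>k. p k x)) \<in> M \<rightarrow>\<^sub>M metric_borel (kantorovich Z)"
proof -
  obtain B where B: "\<And>x y. x \<in> mspace Z \<Longrightarrow> y \<in> mspace Z \<Longrightarrow> mdist Z x y \<le> B"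
    using compact_metric_bounded[OF Z] by blast
  obtain C where C: "countable C" "C \<subseteq> mspace Z"
    "\<And>x r. x \<in> mspace Z \<Longrightarrow> 0 < r \<Longrightarrow> \<exists>c\<in>C. mdist Z c x < r"
    using separable_if_compact_metric[OF Z] by blast
  let ?K = "kantorovich Z"
  let ?e = "\<lambda>x. average_of_points Z n (\<lambda>k. p k x)"
  let ?avg = "\<lambda>cs. average_of_points Z n (\<lambda>k. cs ! k)"
  have p': "p k x \<in> mspace Z" if "x \<in> space M" "k < n" for x k
    using measurable_space[OF p] that by simp
  have e: "?e x \<in> prob_measures Z" if "x \<in> space M" for x
    using n p' that by (intro average_of_points_in_prob_measures) auto
  have avg: "?avg cs \<in> prob_measures Z" if "length cs = n" "set cs \<subseteq> mspace Z" for cs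
    using n that by (intro average_of_points_in_prob_measures) (auto dest!: nth_mem)
  have near: "mdist ?K (?avg cs) (?e x) \<le> r"
    if "length cs = n" "set cs \<subseteq> mspace Z" "x \<in> space M" "\<And>k. k < n \<Longrightarrow> mdist Z (cs ! k) (p k x) \<le> r" for cs x r
  proof -
    have "kantorovich_dist Z (?avg cs) (?e x) \<le> r"
      using that n p' by (intro kantorovich_dist_average_of_points_le) (auto dest!: nth_mem)
    then show ?thesis using mdist_kantorovich[OF B avg e] that by simp
  qed
  show ?thesis
    unfolding metric_borel_def[of ?K]
  proof (rule measurable_measure_of)
    show "{U. openin (mtopology_of ?K) U} \<subseteq> Pow (mspace ?K)"
      by (auto simp: openin_mtopology_of)
    show "?e \<in> space M \<rightarrow> mspace ?K" using e mspace_kantorovich[OF B] by auto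
    fix U assume "U \<in> {U. openin (mtopology_of ?K) U}"
    then have U: "openin (mtopology_of ?K) U" by simp
    define L where "L = {(cs, r::rat). cs \<in> lists C \<and> length cs = n \<and>
      (\<forall>\<nu>\<in>mspace ?K. mdist ?K (?avg cs) \<nu> \<le> of_rat r \<longrightarrow> \<nu> \<in> U)}"
    have cL: "countable L"
      by (rule countable_subset[of _ "lists C \<times> UNIV"]) (use C(1) in \<open>auto simp: L_def\<close>)
    have "?e -` U \<inter> space M = (\<Union>(cs, r)\<in>L. {x \<in> space M. \<forall>k<n. mdist Z (cs ! k) (p k x) < of_rat r})"
      (is "_ = ?R")
    proof
      show "?R \<subseteq> ?e -` U \<inter> space M"
      proof
        fix x assume "x \<in> ?R"
        then obtain cs r where *: "(cs, r) \<in> L" "x \<in> space M" "\<forall>k<n. mdist Z (cs ! k) (p k x) < of_rat r"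
          by blast
        have "mdist ?K (?avg cs) (?e x) \<le> of_rat r"
          using * C(2) by (intro near) (auto simp: L_def less_imp_le)
        then show "x \<in> ?e -` U \<inter> space M"
          using * e[of x] mspace_kantorovich[OF B] by (auto simp: L_def)
      qed
      show "?e -` U \<inter> space M \<subseteq> ?R"
      proof clarify
        fix x assume x: "x \<in> space M" "?e x \<in> U"
        obtain d where d: "d > 0" "\<And>\<nu>. \<nu> \<in> mspace ?K \<Longrightarrow> mdist ?K (?e x) \<nu> < d \<Longrightarrow> \<nu> \<in> U"
          using U x unfolding openin_mtopology_of by blast
        \<comment> \<open>Two steps of length \<open>r < d / 2\<close>: from the average at \<open>x\<close> to that of \<open>cs\<close>, and on to any \<open>\<nu>\<close> near it.\<close>
        obtain r where r: "0 < (of_rat r :: real)" "of_rat r < d / 2"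
          using of_rat_dense[of 0 "d / 2"] d(1) by auto
        have "\<forall>k. \<exists>c. k < n \<longrightarrow> c \<in> C \<and> mdist Z c (p k x) < of_rat r"
          using C(3) p'[OF x(1)] r(1) by blast
        then obtain c where c: "\<And>k. k < n \<Longrightarrow> c k \<in> C" "\<And>k. k < n \<Longrightarrow> mdist Z (c k) (p k x) < of_rat r"
          by metis
        define cs where "cs = map c [0..<n]"
        have cs: "cs \<in> lists C" "length cs = n" "\<And>k. k < n \<Longrightarrow> mdist Z (cs ! k) (p k x) < of_rat r"
          using c by (auto simp: cs_def)
        have csZ: "set cs \<subseteq> mspace Z" using cs(1) C(2) by auto
        have nr: "mdist ?K (?avg cs) (?e x) \<le> of_rat r"
          using cs csZ x by (intro near) (auto simp: less_imp_le)
        have "\<nu> \<in> U" if "\<nu> \<in> mspace ?K" "mdist ?K (?avg cs) \<nu> \<le> of_rat r" for \<nu>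
        proof (rule d(2)[OF that(1)])
          have "mdist ?K (?e x) \<nu> \<le> mdist ?K (?e x) (?avg cs) + mdist ?K (?avg cs) \<nu>"
            using that(1) e[OF x(1)] avg[OF cs(2) csZ] mspace_kantorovich[OF B]
            by (intro mdist_triangle) auto
          then show "mdist ?K (?e x) \<nu> < d"
            using nr that(2) r(2) mdist_commute[of ?K "?e x" "?avg cs"] by linarith
        qed
        then have "(cs, r) \<in> L" using cs by (auto simp: L_def)
        then show "x \<in> ?R" using cs(3) x(1) by blast
      qed
    qed
    also have "\<dots> \<in> sets M"
    proof (rule sets.countable_UN'[OF cL], clarify)
      fix cs r assume L: "(cs, r) \<in> L"
      have "{x \<in> space M. mdist Z (cs ! k) (p k x) < of_rat r} \<in> sets M" if k: "k < n" for k
      proof -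
        have "cs ! k \<in> mspace Z" using L k C(2) by (auto simp: L_def dest!: nth_mem)
        from measurable_compose[OF p[OF k] lipschitz1_measurable[OF lipschitz1_mdist[OF this]]]
        have "(\<lambda>x. mdist Z (p k x) (cs ! k)) \<in> borel_measurable M" .
        then have "{x \<in> space M. mdist Z (p k x) (cs ! k) < of_rat r} \<in> sets M"
          by (rule borel_measurable_less) simp
        then show ?thesis by (simp only: mdist_commute[of Z "cs ! k"])
      qed
      then have "(\<Inter>k\<in>{..<n}. {x \<in> space M. mdist Z (cs ! k) (p k x) < of_rat r}) \<in> sets M"
        using n by (intro sets.finite_INT) (blast | simp)+
      also have "(\<Inter>k\<in>{..<n}. {x \<in> space M. mdist Z (cs ! k) (p k x) < of_rat r})
          = {x \<in> space M. \<forall>k<n. mdist Z (cs ! k) (p k x) < of_rat r}"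
        using n by blast
      finally show "{x \<in> space M. \<forall>k<n. mdist Z (cs ! k) (p k x) < of_rat r} \<in> sets M" .
    qed
    finally show "?e -` U \<inter> space M \<in> sets M" .
  qed
qed

lemma measurable_empirical:
  assumes "compact_space (mtopology_of X)" "f \<in> metric_borel X \<rightarrow>\<^sub>M metric_borel X" "0 < n"
  shows "empirical X f n \<in> metric_borel X \<rightarrow>\<^sub>M metric_borel (kantorovich X)"
proof -
  have "empirical X f n = (\<lambda>x. average_of_points X n (\<lambda>k. (f ^^ k) x))"
    by (simp add: fun_eq_iff empirical_def average_of_points_def)
  moreover have "f ^^ k \<in> metric_borel X \<rightarrow>\<^sub>M metric_borel X" for k
    using assms(2) by (induction k) (auto intro: measurable_comp)
  ultimately show ?thesis
    using measurable_average_of_points[OF assms(1,3), where p = "\<lambda>k. f ^^ k"] by simp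
qed

section \<open>Tail suprema\<close>

text \<open>
  The index \<open>0\<close> is excluded from bound and tails, because the empirical measure of length \<open>0\<close> is the zero
  measure and no probability measure. Boundedness lets the real supremum of a tail agree with the
  extended real one.
\<close>
lemma limsup_less_iff_SUP_tail_less:
  fixes a :: "nat \<Rightarrow> real"
  assumes C: "\<And>k. 1 \<le> k \<Longrightarrow> \<bar>a k\<bar> \<le> C"
  shows "limsup (\<lambda>k. ereal (a k)) < ereal \<epsilon> \<longleftrightarrow> (\<exists>n. (SUP k\<in>{Suc n..}. a k) < \<epsilon>)"
proof -
  have eq: "(SUP k\<in>{Suc n..}. ereal (a k)) = ereal (SUP k\<in>{Suc n..}. a k)" for n
  proof (rule ereal_SUP[symmetric])
    have "(SUP k\<in>{Suc n..}. ereal (a k)) \<le> ereal C"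
      using C by (intro SUP_least) (simp add: abs_le_iff)
    moreover have "ereal (a (Suc n)) \<le> (SUP k\<in>{Suc n..}. ereal (a k))"
      by (intro SUP_upper) simp
    ultimately show "\<bar>SUP k\<in>{Suc n..}. ereal (a k)\<bar> \<noteq> \<infinity>" by auto
  qed
  have "limsup (\<lambda>k. ereal (a k)) = (INF n. SUP k\<in>{n..}. ereal (a k))"
    by (rule limsup_INF_SUP)
  also have "\<dots> = (INF n. SUP k\<in>{Suc n..}. ereal (a k))"
  proof (rule INF_eq)
    fix n :: nat
    show "\<exists>m\<in>UNIV. (SUP k\<in>{Suc m..}. ereal (a k)) \<le> (SUP k\<in>{n..}. ereal (a k))"
      by (intro bexI[of _ n] SUP_subset_mono) auto
    show "\<exists>m\<in>UNIV. (SUP k\<in>{m..}. ereal (a k)) \<le> (SUP k\<in>{Suc n..}. ereal (a k))"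
      by (intro bexI[of _ "Suc n"]) auto
  qed
  finally show ?thesis by (simp add: eq INF_less_iff)
qed

section \<open>Emergence as the limit of quantization numbers\<close>

lemma empirical_law_in_prob_measures:
  assumes "compact_space (mtopology_of X)" "\<mu> \<in> prob_measures X"
    "f \<in> metric_borel X \<rightarrow>\<^sub>M metric_borel X" "0 < k"
  shows "empirical_law X \<mu> f k \<in> prob_measures (kantorovich X)"
proof -
  interpret prob_space \<mu> by (rule prob_measuresD[OF assms(2)])
  have "empirical X f k \<in> \<mu> \<rightarrow>\<^sub>M metric_borel (kantorovich X)"
    using measurable_empirical[OF assms(1,3,4)]
      measurable_cong_sets[OF prob_measuresD(1)[OF assms(2)] refl] by blast
  then show ?thesis
    by (auto simp: prob_measures_def empirical_law_def intro: prob_space_distr)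
qed

text \<open>
  The formula for the distance to a hull, used on the space of measures over \<open>X\<close> and pulled back to
  \<open>X\<close>. Its right-hand side is the integral in the definition of emergence.
\<close>
lemma mdist_set_empirical_law:
  assumes X: "compact_space (mtopology_of X)" and \<mu>: "\<mu> \<in> prob_measures X"
    and f: "f \<in> metric_borel X \<rightarrow>\<^sub>M metric_borel X" and k: "0 < k"
    and I: "finite I" "I \<noteq> {}" "\<And>i. i \<in> I \<Longrightarrow> m i \<in> mspace (kantorovich X)"
  shows "mdist_set (kantorovich (kantorovich X)) (empirical_law X \<mu> f k)
      (measure_convex_hull (metric_borel (kantorovich X))
        ((\<lambda>i. return (metric_borel (kantorovich X)) (m i)) ` I))
    = (\<integral>x. Min ((\<lambda>i. mdist (kantorovich X) (empirical X f k x) (m i)) ` I) \<partial>\<mu>)"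
proof -
  obtain B where B: "\<And>x y. x \<in> mspace X \<Longrightarrow> y \<in> mspace X \<Longrightarrow> mdist X x y \<le> B"
    using compact_metric_bounded[OF X] by blast
  have e: "empirical X f k \<in> \<mu> \<rightarrow>\<^sub>M metric_borel (kantorovich X)"
    using measurable_empirical[OF X f k] measurable_cong_sets[OF prob_measuresD(1)[OF \<mu>] refl] by blast
  have g: "(\<lambda>\<nu>. Min ((\<lambda>i. mdist (kantorovich X) \<nu> (m i)) ` I))
      \<in> borel_measurable (metric_borel (kantorovich X))"
    using I by (intro lipschitz1_measurable lipschitz1_Min lipschitz1_mdist) auto
  have B2: "mdist (kantorovich X) \<nu>1 \<nu>2 \<le> 2 * B"
    if "\<nu>1 \<in> mspace (kantorovich X)" "\<nu>2 \<in> mspace (kantorovich X)" for \<nu>1 \<nu>2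
    using mdist_kantorovich_bounded[OF B] that by simp
  have "(\<integral>\<nu>. Min ((\<lambda>i. mdist (kantorovich X) \<nu> (m i)) ` I) \<partial>empirical_law X \<mu> f k)
    = (\<integral>x. Min ((\<lambda>i. mdist (kantorovich X) (empirical X f k x) (m i)) ` I) \<partial>\<mu>)"
    unfolding empirical_law_def by (rule integral_distr[OF e g])
  then show ?thesis
    using mdist_set_hull_of_point_masses[OF B2 empirical_law_in_prob_measures[OF X \<mu> f k] I]
    by simp
qed

theorem theorem1p14:
  fixes X :: "'a metric" and \<mu> :: "'a measure" and f :: "'a \<Rightarrow> 'a" and \<epsilon> :: real
  assumes "compact_space (mtopology_of X)"
    and "\<mu> \<in> prob_measures X"
    and "f \<in> metric_borel X \<rightarrow>\<^sub>M metric_borel X"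
    and "\<epsilon> > 0"
  shows "(\<lambda>n. quantization_number (kantorovich X) \<epsilon> (empirical_law X \<mu> f) n)
           \<longlonglongrightarrow> metric_emergence X \<mu> f \<epsilon>"
proof -
  let ?K = "kantorovich X"
  obtain B where B: "\<And>x y. x \<in> mspace X \<Longrightarrow> y \<in> mspace X \<Longrightarrow> mdist X x y \<le> B"
    using compact_metric_bounded[OF assms(1)] by blast
  have K: "mspace ?K = prob_measures X" by (rule mspace_kantorovich[OF B])
  interpret prob_space \<mu> by (rule prob_measuresD[OF assms(2)])
  define a where "a N m k = (\<integral>x. Min ((\<lambda>i. mdist ?K (empirical X f k x) (m i)) ` {1..N}) \<partial>\<mu>)"
    for N :: nat and m k
  define adm where "adm N m \<longleftrightarrow> N \<ge> 1 \<and> (\<forall>i\<in>{1..N}. m i \<in> prob_measures X)" for N :: nat and m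
  have a_bound: "\<bar>a N m k\<bar> \<le> 2 * B" if N: "adm N m" and k: "1 \<le> k" for N m k
  proof -
    let ?g = "\<lambda>x. Min ((\<lambda>i. mdist ?K (empirical X f k x) (m i)) ` {1..N})"
    have e: "empirical X f k x \<in> mspace ?K" if "x \<in> space \<mu>" for x
      using measurable_space[OF measurable_empirical[OF assms(1,3)], of k x] that k
        prob_measuresD(2)[OF assms(2)] by simp
    have g: "0 \<le> ?g x \<and> ?g x \<le> 2 * B" if x: "x \<in> space \<mu>" for x
    proof -
      have "?g x \<in> (\<lambda>i. mdist ?K (empirical X f k x) (m i)) ` {1..N}"
        using N by (intro Min_in) (auto simp: adm_def)
      then obtain i where "i \<in> {1..N}" "?g x = mdist ?K (empirical X f k x) (m i)" by blast
      then show ?thesis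
        using mdist_kantorovich_bounded[OF B e[OF x], of "m i"] N K by (auto simp: adm_def)
    qed
    have "0 \<le> a N m k" unfolding a_def using g by (intro integral_nonneg_AE) auto
    moreover have "a N m k \<le> 2 * B"
    \<comment> \<open>In the non-integrable case the integral has the default value \<open>0\<close>, which obeys the bound too.\<close>
    proof (cases "integrable \<mu> ?g")
      case True
      then have "a N m k \<le> (\<integral>x. 2 * B \<partial>\<mu>)" unfolding a_def using g by (intro integral_mono) auto
      then show ?thesis by (simp add: prob_space)
    next
      case False
      obtain x where "x \<in> space \<mu>" using not_empty by blast
      then show ?thesis using False g[of x] by (simp add: a_def not_integrable_integral_eq)
    qed
    ultimately show ?thesis by simp
  qed
  \<comment> \<open>The admissible \<open>N\<close> for the tail from \<open>n + 1\<close> on: the shift avoids the empirical measures of length \<open>0\<close>.\<close>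
  define S where "S n = {enat N | N. \<exists>m. adm N m \<and> (SUP k\<in>{Suc n..}. a N m k) < \<epsilon>}" for n
  have Q: "quantization_number ?K \<epsilon> (empirical_law X \<mu> f) (Suc n) = Inf (S n)" for n
  proof -
    have "(SUP k\<in>{Suc n..}. mdist_set (kantorovich ?K) (empirical_law X \<mu> f k)
           (measure_convex_hull (metric_borel ?K) ((\<lambda>i. return (metric_borel ?K) (m i)) ` {1..N})))
        = (SUP k\<in>{Suc n..}. a N m k)" if "adm N m" for N m
      using that K unfolding a_def
      by (intro SUP_cong refl mdist_set_empirical_law assms) (auto simp: adm_def)
    then show ?thesis
      unfolding quantization_number_def S_def K
      by (intro arg_cong[where f = Inf] Collect_cong) (auto simp: adm_def cong: conj_cong)
  qed
  have E: "metric_emergence X \<mu> f \<epsilon> = (INF n. Inf (S n))"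
  proof -
    have "limsup (\<lambda>k. ereal (a N m k)) < ereal \<epsilon> \<longleftrightarrow> (\<exists>n. (SUP k\<in>{Suc n..}. a N m k) < \<epsilon>)"
      if "adm N m" for N m
      using a_bound[OF that] by (rule limsup_less_iff_SUP_tail_less)
    then have "(\<Union>n. S n) = {enat N | N. \<exists>m. adm N m \<and> limsup (\<lambda>k. ereal (a N m k)) < ereal \<epsilon>}"
      unfolding S_def by blast
    also have "Inf \<dots> = metric_emergence X \<mu> f \<epsilon>"
      unfolding metric_emergence_def a_def[symmetric] adm_def
      by (intro arg_cong[where f = Inf] Collect_cong) blast
    finally have "metric_emergence X \<mu> f \<epsilon> = Inf (\<Union>n. S n)" by (rule sym)
    also have "\<dots> = (INF n. Inf (S n))"
    proof (rule antisym)
      show "Inf (\<Union>n. S n) \<le> (INF n. Inf (S n))"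
        by (intro INF_greatest Inf_superset_mono) auto
      show "(INF n. Inf (S n)) \<le> Inf (\<Union>n. S n)"
      proof (rule Inf_greatest)
        fix N assume "N \<in> (\<Union>n. S n)"
        then obtain n where "N \<in> S n" by auto
        then show "(INF n. Inf (S n)) \<le> N" by (intro INF_lower2[of n] Inf_lower) auto
      qed
    qed
    finally show ?thesis .
  qed
  have "decseq (\<lambda>n. Inf (S n))"
  proof (rule decseq_SucI, rule Inf_superset_mono)
    fix n
    have "(SUP k\<in>{Suc (Suc n)..}. a N m k) \<le> (SUP k\<in>{Suc n..}. a N m k)" if "adm N m" for N m
      using a_bound[OF that] by (intro cSUP_subset_mono bdd_aboveI2[where M = "2 * B"]) (auto simp: abs_le_iff)
    then show "S n \<subseteq> S (Suc n)" unfolding S_def by fastforce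
  qed
  then have "(\<lambda>n. quantization_number ?K \<epsilon> (empirical_law X \<mu> f) (Suc n)) \<longlonglongrightarrow> metric_emergence X \<mu> f \<epsilon>"
    unfolding Q E by (rule LIMSEQ_INF)
  then show ?thesis by (rule LIMSEQ_imp_Suc)
qed

end
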